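(* Let $\varrho>-1$ and let $\Upsilon$ be a positive integer. For all integers $n,m\ge0$, $$\int_0^{\infty}\int_{-\infty}^{\infty}e^{-X^2-Y}\,Y^{\varrho}\;{}_{\Upsilon}H_n^{\varrho}(X,Y)\,Q_m(X,Y)\,dX\,dY=\begin{cases}0,& n\neq m,\\ 2^{n}n!\sqrt{\pi},& n=m,\end{cases}$$ where $Q_m(X,Y)=H_m(X)\sum_{j=0}^m Y_j^{(\varrho)}(Y;\Upsilon)$.
   Context: $(a)_k=a(a+1)\cdots(a+k-1)$, $(a)_0=1$, is the Pochhammer symbol and $[\cdot]$ the integer part. The 2D Hermite–Konhauser polynomials are $${}_{\Upsilon}H_n^{\varrho}(X,Y)=\sum_{s=0}^{[n/2]}\sum_{r=0}^{n-s}\frac{(-1)^s(-n)_{2s}(-n)_{s+r}}{(-n)_s\,\Gamma(\varrho+1+\Upsilon r)\,s!\,r!}(2X)^{n-2s}Y^{\Upsilon r}.$$ The Hermite polynomials are $H_n(X)=\sum_{s=0}^{[n/2]}\frac{(-1)^s(-n)_{2s}}{s!}(2X)^{n-2s}$. The second-kind Konhauser polynomials are $$Y_n^{(\varrho)}(t;\Upsilon)=\frac{1}{n!}\sum_{i=0}^n\frac{t^i}{i!}\sum_{j=0}^i(-1)^j\binom{i}{j}\left(\frac{j+\varrho+1}{\Upsilon}\right)_n.$$ *)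

theory Defs
  imports "HOL-Analysis.Analysis"
begin

definition hermite :: "nat \<Rightarrow> real \<Rightarrow> real" where
  "hermite n X =
     (\<Sum>s=0..n div 2. (-1) ^ s * pochhammer (- real n) (2 * s) / fact s * (2 * X) ^ (n - 2 * s))"

definition konhauser_second :: "nat \<Rightarrow> real \<Rightarrow> nat \<Rightarrow> real \<Rightarrow> real" where
  "konhauser_second k \<rho> n t =
     1 / fact n * (\<Sum>i=0..n. t ^ i / fact i *
       (\<Sum>j=0..i. (-1) ^ j * real (i choose j) * pochhammer ((real j + \<rho> + 1) / real k) n))"

text \<open>The factor \<open>pochhammer (- real n) s\<close> in the denominator is nonzero because
  \<open>s \<le> n div 2 \<le> n\<close>.\<close>

definition hermite_konhauser :: "nat \<Rightarrow> real \<Rightarrow> nat \<Rightarrow> real \<Rightarrow> real \<Rightarrow> real" where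
  "hermite_konhauser k \<rho> n X Y =
     (\<Sum>s=0..n div 2. \<Sum>r=0..n - s.
        ((-1) ^ s * pochhammer (- real n) (2 * s) * pochhammer (- real n) (s + r)) /
        (pochhammer (- real n) s * Gamma (\<rho> + 1 + real (k * r)) * fact s * fact r)
        * (2 * X) ^ (n - 2 * s) * Y ^ (k * r))"

definition hermite_konhauser_Q :: "nat \<Rightarrow> real \<Rightarrow> nat \<Rightarrow> real \<Rightarrow> real \<Rightarrow> real" where
  "hermite_konhauser_Q k \<rho> m X Y = hermite m X * (\<Sum>j=0..m. konhauser_second k \<rho> j Y)"

definition biorth_integrand :: "nat \<Rightarrow> real \<Rightarrow> nat \<Rightarrow> nat \<Rightarrow> real \<Rightarrow> real \<Rightarrow> real" where
  "biorth_integrand k \<rho> n m X Y =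
     exp (- X\<^sup>2 - Y) * Y powr \<rho> * hermite_konhauser k \<rho> n X Y * hermite_konhauser_Q k \<rho> m X Y"

end

theory Submission imports Defs "HOL-Probability.Distributions" begin

text \<open>
  Since \<open>(-n)\<^sub>s\<^sub>+\<^sub>r / (-n)\<^sub>s = (-(n-s))\<^sub>r\<close>, the Hermite--Konhauser polynomial is the \<open>s\<close>-th Hermite term
  times a multiple of the first-kind Konhauser polynomial of degree \<open>n - s\<close>, summed over \<open>s\<close>.
  Integrating in \<open>Y\<close> against \<open>\<Sum>j\<le>m. Y\<^sub>j\<close> keeps, by Konhauser biorthogonality, exactly the terms with
  \<open>n - s \<le> m\<close>; integrating \<open>X^(n-2s)\<close> against \<open>H\<^sub>m\<close> kills those with \<open>n - 2s < m\<close>. Only \<open>s = 0\<close>,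
  \<open>n = m\<close> survives.
\<close>

lemma pochhammer_minus_nat:
  "pochhammer (- real n) k = (-1) ^ k * fact k * real (n choose k)"
  by (simp add: binomial_gbinomial gbinomial_pochhammer mult.assoc[symmetric] flip: power_mult_distrib)

section \<open>Moments of the Gaussian weight\<close>

text \<open>For even \<open>i\<close> this is \<open>Gamma ((i + 1) / 2)\<close>, written with
  factorials.\<close>

definition gauss_moment :: "nat \<Rightarrow> real" where
  "gauss_moment i = (if even i then sqrt pi * fact i / (2 ^ i * fact (i div 2)) else 0)"

lemma has_bochner_integral_gauss_moment:
  "has_bochner_integral lborel (\<lambda>x. exp (- x\<^sup>2) * x ^ i) (gauss_moment i)"
proof -
  \<comment> \<open>This standard deviation makes the weight \<open>sqrt pi\<close> times a centred
    normal density, whose moments are known.\<close>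
  have s: "(1 / sqrt 2 :: real) > 0" by simp
  have d: "normal_density 0 (1 / sqrt 2) x = exp (- x\<^sup>2) / sqrt pi" for x
    by (simp add: normal_density_def power_divide)
  show ?thesis
  proof (cases "even i")
    case True
    then obtain k where k: "i = 2 * k" by (elim evenE)
    from has_bochner_integral_mult_right[OF normal_moment_even[OF s, of 0 k], of "sqrt pi"]
    show ?thesis by (simp add: d k gauss_moment_def power_divide power_mult)
  next
    case False
    then obtain k where k: "i = 2 * k + 1" by (elim oddE)
    from has_bochner_integral_mult_right[OF normal_moment_odd[OF s, of 0 k], of "sqrt pi"]
    show ?thesis by (simp add: d k gauss_moment_def)
  qed
qed

text \<open>Integration by parts, \<open>-2 * x * exp (- x\<^sup>2)\<close> being the derivative of
  the weight. At \<open>j = 0\<close> the truncated \<open>j - 1\<close> is harmless, since its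
  factor is 0.\<close>

lemma gauss_moment_Suc: "2 * gauss_moment (Suc j) = real j * gauss_moment (j - 1)"
proof (cases "even j")
  case False
  then obtain t where t: "j = 2 * t + 1" by (elim oddE)
  have "(4 * fact t + fact t * real t * 4) = (4 * (1 + real t) * fact t :: real)"
    by (simp add: algebra_simps)
  then show ?thesis by (simp add: t gauss_moment_def divide_simps)
qed (auto simp: gauss_moment_def)

section \<open>Hermite coefficients and orthogonality\<close>

definition hermite_coeff :: "nat \<Rightarrow> nat \<Rightarrow> real" where
  "hermite_coeff n s = (-1) ^ s * pochhammer (- real n) (2 * s) / fact s"

lemma hermite_coeff_0 [simp]: "hermite_coeff n 0 = 1"
  by (simp add: hermite_coeff_def)

lemma hermite_coeff_eq_0: "n < 2 * s \<Longrightarrow> hermite_coeff n s = 0"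
  by (simp add: hermite_coeff_def pochhammer_minus_nat)

text \<open>Pascal's rule leaves \<open>n choose (2 * s + 1)\<close> in the difference, and
  absorption reduces it to \<open>n choose (2 * s)\<close>.\<close>

lemma hermite_coeff_Suc:
  "hermite_coeff (Suc n) (Suc s) = hermite_coeff n (Suc s) - 2 * (real n - 2 * real s) * hermite_coeff n s"
proof -
  have "real (Suc (2 * s)) * real (n choose Suc (2 * s)) = real (n - 2 * s) * real (n choose (2 * s))"
    unfolding of_nat_mult[symmetric] binomial_absorption binomial_absorb_comp ..
  \<comment> \<open>Truncated and real subtraction differ only for \<open>2 * s > n\<close>, where
    the binomial vanishes.\<close>
  also have "\<dots> = (real n - 2 * real s) * real (n choose (2 * s))"
    by (cases "2 * s \<le> n") (simp_all add: of_nat_diff)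
  finally have absorb: "(1 + 2 * real s) * real (n choose Suc (2 * s)) = (real n - 2 * real s) * real (n choose (2 * s))"
    by simp
  have fact_quot: "fact (2 * Suc s) / fact (Suc s) = 2 * (1 + 2 * real s) * (fact (2 * s) / fact s)"
    by (simp add: divide_simps) (simp add: algebra_simps)
  have coeff: "hermite_coeff n s = (-1) ^ s * (fact (2 * s) / fact s) * real (n choose (2 * s))" for n s
    unfolding hermite_coeff_def pochhammer_minus_nat by simp
  have "hermite_coeff (Suc n) (Suc s) - hermite_coeff n (Suc s) =
      (-1) ^ Suc s * (fact (2 * Suc s) / fact (Suc s)) * real (n choose Suc (2 * s))"
    unfolding coeff by (simp add: algebra_simps del: fact_Suc)
  also have "\<dots> = - 2 * (-1) ^ s * (fact (2 * s) / fact s) * ((1 + 2 * real s) * real (n choose Suc (2 * s)))"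
    unfolding fact_quot by simp
  also have "\<dots> = - (2 * (real n - 2 * real s) * hermite_coeff n s)"
    unfolding absorb coeff by simp
  finally show ?thesis by simp
qed

text \<open>With \<open>w j = (2 x)^j\<close> this is \<open>H\<^sub>n\<^sub>+\<^sub>1 = 2 x H\<^sub>n - H\<^sub>n'\<close>; the weight \<open>w\<close> is kept abstract
  so that the powers can be replaced by their moments.\<close>

lemma sum_hermite_coeff_Suc:
  fixes w :: "nat \<Rightarrow> real"
  shows "(\<Sum>s\<le>Suc n. hermite_coeff (Suc n) s * w (Suc n - 2 * s)) =
    (\<Sum>s\<le>n. hermite_coeff n s * (w (Suc (n - 2 * s)) - 2 * real (n - 2 * s) * w (n - 2 * s - 1)))"
proof -
  \<comment> \<open>The indices \<open>Suc (n - 2 * s)\<close> and \<open>Suc n - 2 * s\<close> can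
    disagree only where the coefficient is 0; the added term \<open>s = Suc n\<close> is 0
    too.\<close>
  have "(\<Sum>s\<le>n. hermite_coeff n s * w (Suc (n - 2 * s))) =
      (\<Sum>s\<le>Suc n. hermite_coeff n s * w (Suc n - 2 * s))"
    by (rule sum.mono_neutral_cong_left)
       (auto simp: hermite_coeff_eq_0 not_le Suc_diff_le intro!: hermite_coeff_eq_0,
        metis Suc_diff_le hermite_coeff_eq_0 not_le)
  also have "\<dots> = w (Suc n) + (\<Sum>s\<le>n. hermite_coeff n (Suc s) * w (n - 2 * s - 1))"
    by (subst sum.atMost_Suc_shift) simp
  finally have 1: "(\<Sum>s\<le>n. hermite_coeff n s * w (Suc (n - 2 * s))) =
    w (Suc n) + (\<Sum>s\<le>n. hermite_coeff n (Suc s) * w (n - 2 * s - 1))" .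
  have 2: "hermite_coeff n s * (2 * real (n - 2 * s)) = 2 * (real n - 2 * real s) * hermite_coeff n s" for s
    by (cases "2 * s \<le> n") (simp_all add: of_nat_diff hermite_coeff_eq_0)
  have "(\<Sum>s\<le>Suc n. hermite_coeff (Suc n) s * w (Suc n - 2 * s)) =
     w (Suc n) + (\<Sum>s\<le>n. hermite_coeff (Suc n) (Suc s) * w (n - 2 * s - 1))"
    by (subst sum.atMost_Suc_shift) simp
  also have "\<dots> = (\<Sum>s\<le>n. hermite_coeff n s * w (Suc (n - 2 * s))) -
       (\<Sum>s\<le>n. (hermite_coeff n s * (2 * real (n - 2 * s))) * w (n - 2 * s - 1))"
    unfolding 1 2 by (simp add: hermite_coeff_Suc algebra_simps sum_subtractf sum.distrib)
  finally show ?thesis by (simp add: algebra_simps sum_subtractf)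
qed

definition hermite_moment :: "nat \<Rightarrow> nat \<Rightarrow> real" where
  "hermite_moment i n = (\<Sum>s\<le>n. hermite_coeff n s * (2 ^ (n - 2 * s) * gauss_moment (i + (n - 2 * s))))"

text \<open>The coefficients vanish for \<open>2 * s > n\<close>, so the upper limit can be
  \<open>n\<close>, which spares the recursion the floor.\<close>

lemma hermite_altdef: "hermite n x = (\<Sum>s\<le>n. hermite_coeff n s * (2 * x) ^ (n - 2 * s))"
  unfolding hermite_def atMost_atLeast0 hermite_coeff_def[symmetric]
  by (rule sum.mono_neutral_left) (auto simp: intro!: hermite_coeff_eq_0)

lemma has_bochner_integral_hermite_moment:
  "has_bochner_integral lborel (\<lambda>x. exp (- x\<^sup>2) * x ^ i * hermite n x) (hermite_moment i n)"
proof -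
  have "has_bochner_integral lborel
     (\<lambda>x. \<Sum>s\<le>n. hermite_coeff n s * (2 ^ (n - 2 * s) * (exp (- x\<^sup>2) * x ^ (i + (n - 2 * s)))))
     (hermite_moment i n)"
    unfolding hermite_moment_def
    by (intro has_bochner_integral_sum has_bochner_integral_mult_right has_bochner_integral_gauss_moment)
  then show ?thesis
    by (simp add: hermite_altdef sum_distrib_left power_add power_mult_distrib mult_ac)
qed

text \<open>Integration by parts against
  \<open>exp (- x\<^sup>2) * H_(n+1) = - (exp (- x\<^sup>2) * H_n)'\<close>, carried out on the
  moments.\<close>

lemma hermite_moment_Suc: "hermite_moment i (Suc n) = real i * hermite_moment (i - 1) n"
proof -
  \<comment> \<open>The Gaussian recursion yields the factor \<open>i + j\<close>; the derivative
    term removes \<open>j\<close> and leaves \<open>i\<close>.\<close>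
  have *: "2 ^ Suc j * gauss_moment (i + Suc j) - 2 * real j * (2 ^ (j - 1) * gauss_moment (i + (j - 1)))
      = real i * (2 ^ j * gauss_moment (i - 1 + j))" for j
  proof -
    have 1: "2 ^ Suc j * gauss_moment (i + Suc j) = 2 ^ j * (real (i + j) * gauss_moment (i + j - 1))"
      unfolding gauss_moment_Suc[symmetric] by simp
    have 2: "2 * real j * (2 ^ (j - 1) * gauss_moment (i + (j - 1))) =
        2 ^ j * (real j * gauss_moment (i + j - 1))"
      by (cases j) simp_all
    have 3: "real i * (2 ^ j * gauss_moment (i - 1 + j)) = 2 ^ j * (real i * gauss_moment (i + j - 1))"
      by (cases i) simp_all
    show ?thesis unfolding 1 2 3 by (simp only: of_nat_add distrib_left distrib_right add_diff_cancel_right')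
  qed
  show ?thesis
    unfolding hermite_moment_def
    by (subst sum_hermite_coeff_Suc[where w = "\<lambda>j. 2 ^ j * gauss_moment (i + j)"])
       (simp only: * sum_distrib_left mult.left_commute)
qed

text \<open>Each recursion step lowers both indices; as \<open>i < n\<close>, the factor
  \<open>real i\<close> becomes 0 before the degree runs out.\<close>

lemma hermite_moment_eq_0: "i < n \<Longrightarrow> hermite_moment i n = 0"
proof (induction n arbitrary: i)
  case (Suc n)
  then show ?case by (cases i) (simp_all add: hermite_moment_Suc)
qed simp

lemma hermite_moment_self: "hermite_moment n n = fact n * sqrt pi"
  by (induction n) (simp_all add: hermite_moment_Suc, simp add: hermite_moment_def gauss_moment_def)

section \<open>Finite differences and Newton interpolation\<close>

text \<open>Pulling out \<open>n choose q\<close> leaves the binomial expansion of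
  \<open>(1 - 1) ^ (n - q)\<close>.\<close>

lemma sum_alternating_choose_choose:
  "(\<Sum>i\<le>n. (-1) ^ i * real (n choose i) * real (i choose q)) = (if n = q then (-1) ^ n else 0)"
proof (cases "q \<le> n")
  case True
  have "(\<Sum>i\<le>n. (-1) ^ i * real (n choose i) * real (i choose q)) =
      (\<Sum>i\<in>{q..n}. (-1) ^ i * real (n choose i) * real (i choose q))"
    by (rule sum.mono_neutral_right) auto
  also have "\<dots> = (\<Sum>i\<in>{q..n}. (-1) ^ i * real (n choose q) * real ((n - q) choose (i - q)))"
    by (intro sum.cong) (simp_all add: choose_mult mult.assoc flip: of_nat_mult)
  also have "\<dots> = (\<Sum>i\<le>n - q. (-1) ^ (i + q) * real (n choose q) * real ((n - q) choose i))"
    by (rule sum.reindex_bij_witness[of _ "\<lambda>i. i + q" "\<lambda>i. i - q"]) (use True in auto)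
  also have "\<dots> = (-1) ^ q * real (n choose q) * (\<Sum>i\<le>n - q. (-1) ^ i * real ((n - q) choose i))"
    by (simp add: sum_distrib_left power_add mult_ac)
  also have "\<dots> = (if n = q then (-1) ^ n else 0)"
    using choose_alternating_sum[of "n - q", where 'a = real] True by auto
  finally show ?thesis .
qed (auto intro!: sum.neutral)

text \<open>A polynomial in \<open>x\<close> of degree at most \<open>j\<close> expands in the
  binomial basis. Existence of \<open>b\<close> suffices for Newton interpolation.\<close>

lemma pochhammer_affine_gbinomial:
  fixes c d :: real
  shows "\<exists>b. \<forall>x. pochhammer (c + x * d) j = (\<Sum>q\<le>j. b q * (x gchoose q))"
proof (induction j)
  case 0
  show ?case by (auto intro: exI[of _ "\<lambda>_. 1"])
next
  case (Suc j)
  then obtain b where b: "\<And>x. pochhammer (c + x * d) j = (\<Sum>q\<le>j. b q * (x gchoose q))"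
    by blast
  have m: "x * (x gchoose q) = real q * (x gchoose q) + real (Suc q) * (x gchoose Suc q)" for x :: real and q
    using gbinomial_mult_1[of x q] by simp
  \<comment> \<open>Multiplication by \<open>c + j + d * x\<close>: by \<open>m\<close>, one part
    stays at index \<open>q\<close> and the other arrives from \<open>q - 1\<close>.\<close>
  define b' where "b' q = (if q \<le> j then b q * (c + real j + d * real q) else 0) +
     (if q = 0 then 0 else b (q - 1) * d * real q)" for q
  have "pochhammer (c + x * d) (Suc j) = (\<Sum>q\<le>Suc j. b' q * (x gchoose q))" for x
  proof -
    have "pochhammer (c + x * d) (Suc j) = (\<Sum>q\<le>j. b q * ((c + real j) * (x gchoose q) + d * (x * (x gchoose q))))"
      unfolding pochhammer_Suc b sum_distrib_right by (intro sum.cong) (simp_all add: algebra_simps)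
    also have "\<dots> = (\<Sum>q\<le>j. b q * (c + real j + d * real q) * (x gchoose q)) +
        (\<Sum>q\<le>j. b q * d * real (Suc q) * (x gchoose Suc q))"
      unfolding m by (simp add: algebra_simps sum.distrib)
    also have "(\<Sum>q\<le>j. b q * d * real (Suc q) * (x gchoose Suc q)) =
        (\<Sum>q\<le>Suc j. (if q = 0 then 0 else b (q - 1) * d * real q) * (x gchoose q))"
      by (subst sum.atMost_Suc_shift) simp
    also have "(\<Sum>q\<le>j. b q * (c + real j + d * real q) * (x gchoose q)) =
       (\<Sum>q\<le>Suc j. (if q \<le> j then b q * (c + real j + d * real q) else 0) * (x gchoose q))"
      by simp
    finally show ?thesis
      unfolding b'_def by (simp only: sum.distrib[symmetric] distrib_right)
  qed
  then show ?case by blast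
qed

text \<open>The inner sum is \<open>(-1) ^ i\<close> times the \<open>i\<close>-th forward
  difference of \<open>f\<close> at 0, which is \<open>b i\<close>; the outer sum is then the Newton
  series at \<open>- a\<close>.\<close>

lemma newton_interpolation:
  fixes f :: "real \<Rightarrow> real"
  assumes "\<And>x. f x = (\<Sum>q\<le>j. b q * (x gchoose q))"
  shows "(\<Sum>i\<le>j. pochhammer a i / fact i * (\<Sum>l\<le>i. (-1) ^ l * real (i choose l) * f (real l))) = f (- a)"
proof -
  have "(\<Sum>l\<le>i. (-1) ^ l * real (i choose l) * f (real l)) = (-1) ^ i * b i" if "i \<le> j" for i
  proof -
    have "(\<Sum>l\<le>i. (-1) ^ l * real (i choose l) * f (real l)) =
       (\<Sum>l\<le>i. \<Sum>q\<le>j. b q * ((-1) ^ l * real (i choose l) * real (l choose q)))"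
      by (simp add: assms sum_distrib_left binomial_gbinomial mult_ac)
    also have "\<dots> = (\<Sum>q\<le>j. b q * (\<Sum>l\<le>i. (-1) ^ l * real (i choose l) * real (l choose q)))"
      by (subst sum.swap) (simp add: sum_distrib_left)
    also have "\<dots> = (\<Sum>q\<le>j. if i = q then (-1) ^ i * b q else 0)"
      by (intro sum.cong) (simp_all add: sum_alternating_choose_choose)
    also have "\<dots> = (-1) ^ i * b i" using that by simp
    finally show ?thesis .
  qed
  then have "(\<Sum>i\<le>j. pochhammer a i / fact i * (\<Sum>l\<le>i. (-1) ^ l * real (i choose l) * f (real l))) =
     (\<Sum>i\<le>j. pochhammer a i / fact i * ((-1) ^ i * b i))"
    by (intro sum.cong) auto
  also have "\<dots> = f (- a)"
    unfolding assms by (intro sum.cong) (simp_all add: gbinomial_pochhammer)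
  finally show ?thesis .
qed

section \<open>Konhauser biorthogonality\<close>

text \<open>The first-kind Konhauser polynomial, scaled by \<open>n! / \<Gamma>(k n + \<rho> + 1)\<close>
  so that it is biorthonormal to the second kind.\<close>

definition konhauser_first :: "nat \<Rightarrow> real \<Rightarrow> nat \<Rightarrow> real \<Rightarrow> real" where
  "konhauser_first k \<rho> n t =
     (\<Sum>r\<le>n. (-1) ^ r * real (n choose r) / Gamma (\<rho> + 1 + real (k * r)) * t ^ (k * r))"

lemma hermite_konhauser_altdef:
  "hermite_konhauser k \<rho> n X Y =
     (\<Sum>s=0..n div 2. hermite_coeff n s * (2 * X) ^ (n - 2 * s) * konhauser_first k \<rho> (n - s) Y)"
  unfolding hermite_konhauser_def konhauser_first_def sum_distrib_left atMost_atLeast0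
proof (intro sum.cong refl, goal_cases)
  case (1 s r)
  then have "s \<le> n" by auto
  then have nz: "pochhammer (- real n) s \<noteq> 0" by (simp add: pochhammer_minus_nat)
  have "- real n + real s = - real (n - s)" using \<open>s \<le> n\<close> by simp
  then have "pochhammer (- real n) (s + r) = pochhammer (- real n) s * pochhammer (- real (n - s)) r"
    by (simp only: pochhammer_product')
  then show ?case using nz
    by (simp add: hermite_coeff_def pochhammer_minus_nat[of "n - s"] divide_simps)
qed

lemma has_bochner_integral_gamma_moment:
  fixes \<rho> :: real
  assumes "\<rho> > -1"
  shows "has_bochner_integral lborel (\<lambda>t. indicator {0<..} t * (exp (- t) * t powr \<rho> * t ^ a)) (Gamma (\<rho> + 1 + real a))"
proof (rule has_bochner_integral_nn_integral)
  have "((\<lambda>t. t powr (\<rho> + 1 + real a - 1) / exp t) has_integral Gamma (\<rho> + 1 + real a)) {0..}"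
    by (rule Gamma_integral_real) (use assms in linarith)
  from nn_integral_has_integral_lebesgue[OF _ this]
  have "(\<integral>\<^sup>+t. ennreal (indicator {0..} t * (t powr (\<rho> + real a) / exp t)) \<partial>lborel) = ennreal (Gamma (\<rho> + 1 + real a))"
    by simp
  \<comment> \<open>Passing from \<open>{0..}\<close> to \<open>{0<..}\<close> is exact even at 0,
    because \<open>0 powr x = 0\<close>.\<close>
  moreover have "indicator {0<..} t * (exp (- t) * t powr \<rho> * t ^ a) =
     indicator {0..} t * (t powr (\<rho> + real a) / exp t)" for t :: real
    by (cases "t > 0"; cases "t = 0")
       (simp_all add: powr_add powr_realpow exp_minus field_simps)
  ultimately show "(\<integral>\<^sup>+t. ennreal (indicator {0<..} t * (exp (- t) * t powr \<rho> * t ^ a)) \<partial>lborel) = ennreal (Gamma (\<rho> + 1 + real a))"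
    by simp
  show "0 \<le> Gamma (\<rho> + 1 + real a)"
    by (rule Gamma_real_nonneg) (use assms in linarith)
qed (auto simp: indicator_def)

text \<open>Termwise integration gives a double sum of Gamma values. Its inner sum is evaluated by
  interpolation, its outer one by the alternating binomial identity.\<close>

lemma konhauser_biorthogonal:
  fixes \<rho> :: real
  assumes \<rho>: "\<rho> > -1" and k: "k > 0"
  shows "has_bochner_integral lborel
     (\<lambda>t. indicator {0<..} t * (exp (- t) * t powr \<rho> * konhauser_first k \<rho> n t * konhauser_second k \<rho> j t))
     (if j = n then 1 else 0)"
proof -
  define f where "f x = pochhammer ((x + \<rho> + 1) / real k) j" for x
  define D where "D i = (\<Sum>l\<le>i. (-1) ^ l * real (i choose l) * f (real l))" for i
  define z where "z r = (-1) ^ r * real (n choose r) / Gamma (\<rho> + 1 + real (k * r))" for r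
  obtain b where "\<forall>x. pochhammer ((\<rho> + 1) / real k + x * (1 / real k)) j = (\<Sum>q\<le>j. b q * (x gchoose q))"
    using pochhammer_affine_gbinomial by blast
  moreover have "(x + \<rho> + 1) / real k = (\<rho> + 1) / real k + x * (1 / real k)" for x
    by (simp add: add_divide_distrib)
  ultimately have b: "f x = (\<Sum>q\<le>j. b q * (x gchoose q))" for x
    by (simp add: f_def)
  \<comment> \<open>After dividing by \<open>\<Gamma>(\<rho> + 1 + k r)\<close>, the sum over \<open>i\<close> is Newton's expansion
    of \<open>f\<close> at \<open>-(\<rho> + 1 + k r)\<close>, where \<open>f\<close> takes the value \<open>(-r)\<^sub>j\<close>.\<close>
  have "(\<Sum>r\<le>n. \<Sum>i\<le>j. z r * (D i / fact i / fact j * Gamma (\<rho> + 1 + real (k * r + i)))) =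
      (\<Sum>r\<le>n. (-1) ^ r * real (n choose r) * ((-1) ^ j * real (r choose j)))"
  proof (intro sum.cong refl)
    fix r
    have pos: "\<rho> + 1 + real (k * r) > 0" using \<rho> by (simp add: add_pos_nonneg)
    then have G: "Gamma (\<rho> + 1 + real (k * r)) > 0" by (rule Gamma_real_pos)
    have "Gamma (\<rho> + 1 + real (k * r + i)) = pochhammer (\<rho> + 1 + real (k * r)) i * Gamma (\<rho> + 1 + real (k * r))" for i
    proof -
      have "\<rho> + 1 + real (k * r) \<notin> \<int>\<^sub>\<le>\<^sub>0"
        using pos nonpos_Ints_nonpos by fastforce
      from pochhammer_Gamma[OF this, of i] show ?thesis
        using G by (simp add: field_simps)
    qed
    then have "(\<Sum>i\<le>j. z r * (D i / fact i / fact j * Gamma (\<rho> + 1 + real (k * r + i)))) =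
       (-1) ^ r * real (n choose r) * ((\<Sum>i\<le>j. pochhammer (\<rho> + 1 + real (k * r)) i / fact i * D i) / fact j)"
      using G by (simp add: z_def sum_distrib_left sum_divide_distrib mult_ac)
    also have "(\<Sum>i\<le>j. pochhammer (\<rho> + 1 + real (k * r)) i / fact i * D i) = f (- (\<rho> + 1 + real (k * r)))"
      unfolding D_def by (rule newton_interpolation[OF b])
    also have "\<dots> = pochhammer (- real r) j" using k by (simp add: f_def)
    also have "\<dots> / fact j = (-1) ^ j * real (r choose j)" by (simp add: pochhammer_minus_nat)
    finally show "(\<Sum>i\<le>j. z r * (D i / fact i / fact j * Gamma (\<rho> + 1 + real (k * r + i)))) =
      (-1) ^ r * real (n choose r) * ((-1) ^ j * real (r choose j))" .
  qed
  also have "\<dots> = (-1) ^ j * (\<Sum>r\<le>n. (-1) ^ r * real (n choose r) * real (r choose j))"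
    by (simp add: sum_distrib_left mult_ac)
  \<comment> \<open>On the diagonal the signs \<open>(-1) ^ j\<close> and \<open>(-1) ^ n\<close>
    cancel.\<close>
  also have "\<dots> = (if j = n then 1 else 0)"
    by (simp add: sum_alternating_choose_choose flip: power_mult_distrib)
  finally have integral_eq: "(\<Sum>r\<le>n. \<Sum>i\<le>j. z r * (D i / fact i / fact j * Gamma (\<rho> + 1 + real (k * r + i)))) =
    (if j = n then 1 else 0)" .
  have "has_bochner_integral lborel
     (\<lambda>t. \<Sum>r\<le>n. \<Sum>i\<le>j. z r * (D i / fact i / fact j * (indicator {0<..} t * (exp (- t) * t powr \<rho> * t ^ (k * r + i)))))
     (\<Sum>r\<le>n. \<Sum>i\<le>j. z r * (D i / fact i / fact j * Gamma (\<rho> + 1 + real (k * r + i))))"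
    by (intro has_bochner_integral_sum has_bochner_integral_mult_right has_bochner_integral_gamma_moment \<rho>)
  moreover have "(\<Sum>r\<le>n. \<Sum>i\<le>j. z r * (D i / fact i / fact j * (indicator {0<..} t * (exp (- t) * t powr \<rho> * t ^ (k * r + i)))))
     = indicator {0<..} t * (exp (- t) * t powr \<rho> * konhauser_first k \<rho> n t * konhauser_second k \<rho> j t)" for t
  proof -
    have 1: "konhauser_first k \<rho> n t = (\<Sum>r\<le>n. z r * t ^ (k * r))"
      by (simp add: konhauser_first_def z_def)
    have 2: "konhauser_second k \<rho> j t = (\<Sum>i\<le>j. D i / fact i / fact j * t ^ i)"
      by (simp add: konhauser_second_def D_def f_def atMost_atLeast0 sum_distrib_left sum_divide_distrib mult_ac)
    show ?thesis
      unfolding 1 2 by (simp add: sum_product sum_distrib_left sum_distrib_right power_add mult_ac)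
  qed
  ultimately show ?thesis by (simp only: integral_eq)
qed

section \<open>Integration over the half-plane\<close>

lemma integrable_lborel_mult_prod:
  fixes f g :: "real \<Rightarrow> real"
  assumes f: "integrable lborel f" and g: "integrable lborel g"
  shows "integrable lborel (\<lambda>(x, y). f x * g y)"
proof -
  note [measurable] = borel_measurable_integrable[OF f] borel_measurable_integrable[OF g]
  have "integrable (lborel \<Otimes>\<^sub>M lborel) (\<lambda>(x, y). f x * g y)"
  proof (rule lborel_pair.Fubini_integrable)
    show "integrable lborel (\<lambda>x. \<integral>y. norm (case (x, y) of (x, y) \<Rightarrow> f x * g y) \<partial>lborel)"
      using f by (simp add: abs_mult)
  qed (use f g in \<open>auto\<close>)
  then show ?thesis by (simp add: lborel_prod)
qed

theorem theorem3:
  fixes \<rho> :: real and k n m :: nat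
  assumes "\<rho> > -1" and "k > 0"
  shows "set_integrable lborel (UNIV \<times> {0<..}) (\<lambda>(X, Y). biorth_integrand k \<rho> n m X Y) \<and>
    (LBINT Y:{0<..}. LBINT X. biorth_integrand k \<rho> n m X Y) =
      (if n = m then 2 ^ n * fact n * sqrt pi else 0)"
proof -
  \<comment> \<open>For each \<open>s\<close> the integrand separates into
    \<open>f s X * g s Y\<close>; \<open>F s\<close> and \<open>G s\<close> are the integrals of the
    factors, the second over \<open>{0<..}\<close>.\<close>
  define f where "f s X = hermite_coeff n s * 2 ^ (n - 2 * s) * (exp (- X\<^sup>2) * X ^ (n - 2 * s) * hermite m X)" for s X
  define F where "F s = hermite_coeff n s * 2 ^ (n - 2 * s) * hermite_moment (n - 2 * s) m" for s
  define g where "g s Y = exp (- Y) * Y powr \<rho> * konhauser_first k \<rho> (n - s) Y *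
    (\<Sum>j\<le>m. konhauser_second k \<rho> j Y)" for s Y
  \<comment> \<open>Biorthogonality retains only \<open>j = n - s\<close>, which occurs in the sum
    exactly when \<open>n - s \<le> m\<close>.\<close>
  define G :: "nat \<Rightarrow> real" where "G s = (if n - s \<le> m then 1 else 0)" for s
  have split: "biorth_integrand k \<rho> n m X Y = (\<Sum>s=0..n div 2. f s X * g s Y)" for X Y
    unfolding biorth_integrand_def hermite_konhauser_Q_def hermite_konhauser_altdef atMost_atLeast0[symmetric]
    by (simp add: f_def g_def sum_distrib_left sum_distrib_right power_mult_distrib exp_diff exp_minus field_simps)
  have f: "has_bochner_integral lborel (f s) (F s)" for s
    unfolding f_def F_def
    by (intro has_bochner_integral_mult_right has_bochner_integral_hermite_moment)
  have g: "has_bochner_integral lborel (\<lambda>Y. indicator {0<..} Y * g s Y) (G s)" for s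
  proof -
    have "has_bochner_integral lborel
       (\<lambda>t. \<Sum>j\<le>m. indicator {0<..} t * (exp (- t) * t powr \<rho> * konhauser_first k \<rho> (n - s) t * konhauser_second k \<rho> j t))
       (\<Sum>j\<le>m. if j = n - s then 1 else 0)"
      by (intro has_bochner_integral_sum konhauser_biorthogonal assms)
    then show ?thesis by (simp add: g_def G_def sum_distrib_left mult.assoc)
  qed
  \<comment> \<open>The indicator of the half-plane depends on \<open>Y\<close> alone, so each
    summand remains a product of integrable one-variable functions.\<close>
  have "integrable lborel (\<lambda>p. \<Sum>s=0..n div 2. (\<lambda>(X, Y). f s X * (indicator {0<..} Y * g s Y)) p)"
    using f g by (intro Bochner_Integration.integrable_sum integrable_lborel_mult_prod)
      (auto simp: has_bochner_integral_iff)
  then have int: "set_integrable lborel (UNIV \<times> {0<..}) (\<lambda>(X, Y). biorth_integrand k \<rho> n m X Y)"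
    unfolding set_integrable_def
    by (rule Bochner_Integration.integrable_cong[THEN iffD1, rotated -1])
       (auto simp: split sum_distrib_left indicator_def intro!: sum.neutral)
  have "(LBINT X. biorth_integrand k \<rho> n m X Y) = (\<Sum>s=0..n div 2. F s * g s Y)" for Y
    unfolding split
    by (rule has_bochner_integral_integral_eq) (intro has_bochner_integral_sum has_bochner_integral_mult_left f)
  then have "(LBINT Y:{0<..}. LBINT X. biorth_integrand k \<rho> n m X Y) =
      (LBINT Y. (\<Sum>s=0..n div 2. F s * (indicator {0<..} Y * g s Y)))"
    by (simp add: set_lebesgue_integral_def sum_distrib_left mult_ac)
  also have "\<dots> = (\<Sum>s=0..n div 2. F s * G s)"
    by (rule has_bochner_integral_integral_eq) (intro has_bochner_integral_sum has_bochner_integral_mult_right g)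
  also have "\<dots> = (\<Sum>s=0..n div 2. if s = 0 then (if n = m then 2 ^ n * fact n * sqrt pi else 0) else 0)"
  proof (intro sum.cong refl)
    fix s assume "s \<in> {0..n div 2}"
    then have s: "2 * s \<le> n" by auto
    \<comment> \<open>A nonzero term needs \<open>n - s \<le> m \<le> n - 2 s\<close>.\<close>
    consider "n - 2 * s < m" | "n - s > m" | "s = 0" "n = m" using s by linarith
    then show "F s * G s = (if s = 0 then (if n = m then 2 ^ n * fact n * sqrt pi else 0) else 0)"
      using s by cases (auto simp: F_def G_def hermite_moment_eq_0 hermite_moment_self)
  qed
  also have "\<dots> = (if n = m then 2 ^ n * fact n * sqrt pi else 0)" by simp
  finally show ?thesis using int by blast
qed

end
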